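(* Let $m\geq 2$ and $n=\binom{m}{2}$. Then the generic completion rank of the complete bipartite graph $K_{m,n}$ (color classes of sizes $m$ and $n$) equals $m$.
   Context: For a simple graph $H=(V,E)$ on $N$ vertices, $\pi_H:\mathrm{Sym}_N\to\mathbb{R}^N\oplus\mathbb{R}^E$ is $(a_{ij})\mapsto((a_{ii})_{i},(a_{ij})_{\{i,j\}\in E})$, and $V_r$ is the variety of symmetric $N\times N$ matrices of rank at most $r$. The generic completion rank $\mathrm{gcr}(H)$ is the smallest $r$ such that $\pi_H|_{V_r}$ is dominant, i.e. $\dim\pi_H(V_r)=N+|E|$. *)

theory Defs
  imports "HOL-Analysis.Analysis"
begin

text \<open>A graph on the vertex type \<open>'v\<close> (so N is \<open>CARD('v)\<close>) is given by its set of edges,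
  each edge being an unordered pair of distinct vertices.\<close>

definition simple_graph :: "'v set set \<Rightarrow> bool" where
  "simple_graph E \<longleftrightarrow> (\<forall>e\<in>E. card e = 2)"

definition complete_bipartite :: "'v set \<Rightarrow> 'v set \<Rightarrow> 'v set set" where
  "complete_bipartite A B = {{a, b} | a b. a \<in> A \<and> b \<in> B}"

lemma simple_graph_complete_bipartite:
  "A \<inter> B = {} \<Longrightarrow> simple_graph (complete_bipartite A B)"
  by (auto simp: simple_graph_def complete_bipartite_def card_insert_if)

definition sym_rank_variety :: "nat \<Rightarrow> (real^'v^'v) set" where
  "sym_rank_variety r = {M. transpose M = M \<and> rank M \<le> r}"

text \<open>Unambiguous only for symmetric matrices, see \<open>edge_entry_eq\<close>.\<close>

definition edge_entry :: "real^'v^'v \<Rightarrow> 'v set \<Rightarrow> real" where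
  "edge_entry M e = (THE c. \<exists>i j. e = {i, j} \<and> i \<noteq> j \<and> c = M $ i $ j)"

lemma edge_entry_eq:
  assumes "transpose M = M" "i \<noteq> j"
  shows "edge_entry M {i, j} = M $ i $ j"
proof -
  have "M $ j $ i = M $ i $ j"
    using assms(1) by (metis transpose_def vec_lambda_beta)
  then show ?thesis
    unfolding edge_entry_def using assms(2)
    by (intro the_equality) (auto simp: doubleton_eq_iff)
qed

text \<open>Since the edge set is a value and not a type, the space $R^N \oplus R^E$ is realised as the
  coordinate subspace of $R^N \oplus R^{P(V)}$ on which all coordinates outside \<open>E\<close> vanish.\<close>

definition partial_matrix_space :: "'v::finite set set \<Rightarrow> ((real^'v) \<times> (real^('v set))) set" where
  "partial_matrix_space E = {(d, w). \<forall>e. e \<notin> E \<longrightarrow> w $ e = 0}"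

definition graph_proj :: "'v::finite set set \<Rightarrow> real^'v^'v \<Rightarrow> (real^'v) \<times> (real^('v set))" where
  "graph_proj E M = ((\<chi> i. M $ i $ i), (\<chi> e. if e \<in> E then edge_entry M e else 0))"

text \<open>For a linear subspace \<open>T\<close> (an affine space) and \<open>S \<subseteq> T\<close>. Over the reals a polynomial is
  determined by its polynomial function.\<close>

definition zariski_dense_in :: "'b::real_normed_vector set \<Rightarrow> 'b set \<Rightarrow> bool" where
  "zariski_dense_in S T \<longleftrightarrow> S \<subseteq> T \<and>
     (\<forall>p. real_polynomial_function p \<and> (\<forall>x\<in>S. p x = 0) \<longrightarrow> (\<forall>x\<in>T. p x = 0))"

definition proj_dominant :: "'v::finite set set \<Rightarrow> nat \<Rightarrow> bool" where
  "proj_dominant E r \<longleftrightarrow>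
     zariski_dense_in (graph_proj E ` sym_rank_variety r) (partial_matrix_space E)"

definition gcr :: "'v::finite set set \<Rightarrow> nat" where
  "gcr E = (LEAST r. proj_dominant E r)"


subsection \<open>Dominance in terms of dimension\<close>

definition coord_proj :: "'b::euclidean_space set \<Rightarrow> 'b \<Rightarrow> 'b" where
  "coord_proj J x = (\<Sum>b\<in>J. (x \<bullet> b) *\<^sub>R b)"

text \<open>The coordinates in \<open>J\<close> are algebraically independent as functions on \<open>S\<close>.\<close>

definition coords_independent_on :: "'b::euclidean_space set \<Rightarrow> 'b set \<Rightarrow> bool" where
  "coords_independent_on S J \<longleftrightarrow> J \<subseteq> Basis \<and>
     (\<forall>p. real_polynomial_function p \<and> (\<forall>x\<in>S. p (coord_proj J x) = 0) \<longrightarrow>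
          (\<forall>x. p (coord_proj J x) = 0))"

text \<open>The dimension of the Zariski closure of a nonempty set \<open>S\<close>, as the maximal number of
  coordinates that are algebraically independent modulo the vanishing ideal of \<open>S\<close>.\<close>

definition zariski_dim :: "'b::euclidean_space set \<Rightarrow> nat" where
  "zariski_dim S = Max (card ` {J. coords_independent_on S J})"

definition pm_basis :: "'v::finite set set \<Rightarrow> ((real^'v) \<times> (real^('v set))) set" where
  "pm_basis E = (\<lambda>i. (axis i 1, 0)) ` UNIV \<union> (\<lambda>e. (0, axis e 1)) ` E"

lemma pm_basis_subset: "pm_basis E \<subseteq> Basis"
  by (auto simp: pm_basis_def Basis_prod_def Basis_vec_def)

lemma card_pm_basis: "card (pm_basis E) = CARD('v) + card (E :: 'v::finite set set)"
proof -
  have "card (pm_basis E) =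
      card ((\<lambda>i. (axis i 1, 0)) ` (UNIV::'v set) :: ((real^'v) \<times> (real^('v set))) set)
      + card ((\<lambda>e. (0, axis e 1)) ` E :: ((real^'v) \<times> (real^('v set))) set)"
    unfolding pm_basis_def by (intro card_Un_disjoint) (auto simp: axis_eq_0_iff)
  then show ?thesis
    by (simp add: card_image inj_on_def axis_eq_axis)
qed

lemma coord_proj_pm_basis:
  "coord_proj (pm_basis E) x = (fst x, \<chi> e. if e \<in> E then snd x $ e else 0)"
proof -
  have "coord_proj (pm_basis E) x =
      (\<Sum>b\<in>(\<lambda>i. (axis i 1, 0)) ` UNIV. (x \<bullet> b) *\<^sub>R b) +
      (\<Sum>b\<in>(\<lambda>e. (0, axis e 1)) ` E. (x \<bullet> b) *\<^sub>R b)"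
    unfolding pm_basis_def coord_proj_def
    by (intro sum.union_disjoint) (auto simp: axis_eq_0_iff)
  also have "\<dots> = (\<Sum>i\<in>UNIV. (x \<bullet> (axis i 1, 0)) *\<^sub>R (axis i 1, 0)) +
      (\<Sum>e\<in>E. (x \<bullet> (0, axis e 1)) *\<^sub>R (0, axis e 1))"
    by (subst (1 2) sum.reindex) (auto simp: inj_on_def axis_eq_axis)
  also have "\<dots> = (fst x, \<chi> e. if e \<in> E then snd x $ e else 0)"
  proof (rule prod_eqI, goal_cases)
    case 1
    show ?case
      by (simp add: fst_sum vec_eq_iff inner_prod_def inner_axis)
        (simp add: axis_def mult_delta_right)
  next
    case 2
    show ?case
      by (simp add: snd_sum vec_eq_iff inner_prod_def inner_axis)
        (simp add: axis_def mult_delta_right)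
  qed
  finally show ?thesis .
qed

lemma graph_proj_in: "graph_proj E M \<in> partial_matrix_space E"
  by (simp add: graph_proj_def partial_matrix_space_def)

lemma range_coord_proj_pm_basis: "range (coord_proj (pm_basis E)) = partial_matrix_space E"
proof
  show "range (coord_proj (pm_basis E)) \<subseteq> partial_matrix_space E"
    by (auto simp: coord_proj_pm_basis partial_matrix_space_def)
next
  show "partial_matrix_space E \<subseteq> range (coord_proj (pm_basis E))"
  proof
    fix x assume "x \<in> partial_matrix_space E"
    then have "x = coord_proj (pm_basis E) x"
      by (auto simp: coord_proj_pm_basis partial_matrix_space_def vec_eq_iff)
    then show "x \<in> range (coord_proj (pm_basis E))" by blast
  qed
qed

lemma coord_proj_id: "x \<in> partial_matrix_space E \<Longrightarrow> coord_proj (pm_basis E) x = x"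
  by (auto simp: coord_proj_pm_basis partial_matrix_space_def vec_eq_iff)

lemma dense_iff_independent:
  assumes "S \<subseteq> partial_matrix_space E"
  shows "zariski_dense_in S (partial_matrix_space E) \<longleftrightarrow> coords_independent_on S (pm_basis E)"
proof -
  have "(\<forall>x\<in>S. p (coord_proj (pm_basis E) x) = 0) \<longleftrightarrow> (\<forall>x\<in>S. p x = 0)" for p :: "_ \<Rightarrow> real"
    using assms by (auto simp: coord_proj_id subset_iff)
  moreover have "(\<forall>x. p (coord_proj (pm_basis E) x) = 0) \<longleftrightarrow> (\<forall>x\<in>partial_matrix_space E. p x = 0)"
    for p :: "_ \<Rightarrow> real"
    by (auto simp flip: range_coord_proj_pm_basis)
  ultimately show ?thesis
    using assms pm_basis_subset [of E]
    by (simp add: zariski_dense_in_def coords_independent_on_def)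
qed

lemma coord_proj_inner:
  assumes "J \<subseteq> Basis" "b \<in> J"
  shows "coord_proj J x \<bullet> b = x \<bullet> b"
proof -
  have "finite J" using assms(1) finite_Basis finite_subset by blast
  have "coord_proj J x \<bullet> b = (\<Sum>c\<in>J. (x \<bullet> c) * (c \<bullet> b))"
    by (simp add: coord_proj_def inner_sum_left)
  also have "\<dots> = (\<Sum>c\<in>J. if c = b then x \<bullet> c else 0)"
    using assms by (intro sum.cong) (auto simp: inner_Basis subset_iff)
  finally show ?thesis using \<open>finite J\<close> assms(2) by simp
qed

lemma independent_subset_pm_basis:
  assumes S: "S \<subseteq> partial_matrix_space E" and J: "coords_independent_on S J"
  shows "J \<subseteq> pm_basis E"
proof
  fix b assume b: "b \<in> J"
  have JB: "J \<subseteq> Basis" using J by (simp add: coords_independent_on_def)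
  have p: "real_polynomial_function (\<lambda>x. x \<bullet> b)"
    by (rule real_polynomial_function.intros(1) [OF bounded_linear_inner_left])
  show "b \<in> pm_basis E"
  proof (rule ccontr)
    assume nb: "b \<notin> pm_basis E"
    from b JB have "b \<in> Basis" by blast
    with nb obtain e where e: "b = (0, axis e 1)" "e \<notin> E"
      by (auto simp: pm_basis_def Basis_prod_def Basis_vec_def)
    have "\<forall>x\<in>S. x \<bullet> b = 0"
      using S e by (auto simp: partial_matrix_space_def inner_axis)
    then have "\<forall>x\<in>S. coord_proj J x \<bullet> b = 0"
      by (simp add: coord_proj_inner [OF JB b])
    then have "\<forall>x. coord_proj J x \<bullet> b = 0"
      using J p unfolding coords_independent_on_def by blast
    then have "b \<bullet> b = 0"
      using coord_proj_inner [OF JB b] by metis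
    then show False using \<open>b \<in> Basis\<close> by simp
  qed
qed

theorem proj_dominant_iff_dim:
  fixes E :: "'v::finite set set"
  shows "proj_dominant E r \<longleftrightarrow>
    zariski_dim (graph_proj E ` sym_rank_variety r) = CARD('v) + card E"
proof -
  let ?S = "graph_proj E ` sym_rank_variety r"
  let ?I = "{J. coords_independent_on ?S J}"
  have S: "?S \<subseteq> partial_matrix_space E" using graph_proj_in by blast
  have "(0::real^'v^'v) \<in> sym_rank_variety r"
    by (auto simp: sym_rank_variety_def transpose_def vec_eq_iff)
  then have "?S \<noteq> {}" by blast
  then have "coords_independent_on ?S {}"
    by (auto simp: coords_independent_on_def coord_proj_def)
  then have ne: "?I \<noteq> {}" by blast
  have sub: "J \<subseteq> pm_basis E" if "J \<in> ?I" for J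
    using independent_subset_pm_basis [OF S] that by blast
  have finb: "finite (pm_basis E)" by (simp add: pm_basis_def)
  then have fin: "finite ?I"
    using sub by (intro finite_subset [of ?I "Pow (pm_basis E)"]) auto
  have "proj_dominant E r \<longleftrightarrow> pm_basis E \<in> ?I"
    using dense_iff_independent [OF S] by (simp add: proj_dominant_def)
  also have "\<dots> \<longleftrightarrow> Max (card ` ?I) = card (pm_basis E)"
  proof
    assume "pm_basis E \<in> ?I"
    then show "Max (card ` ?I) = card (pm_basis E)"
      using fin finb sub by (intro Max_eqI) (auto intro: card_mono)
  next
    assume eq: "Max (card ` ?I) = card (pm_basis E)"
    have "Max (card ` ?I) \<in> card ` ?I" using fin ne by (intro Max_in) auto
    then obtain J where "J \<in> ?I" "card J = card (pm_basis E)" using eq by auto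
    then show "pm_basis E \<in> ?I" using sub finb card_subset_eq by metis
  qed
  finally show ?thesis by (simp add: zariski_dim_def card_pm_basis)
qed

text \<open>The minimum in \<open>gcr\<close> exists: every partial matrix has a completion.\<close>

lemma proj_dominant_card:
  fixes E :: "'v::finite set set"
  assumes "simple_graph E"
  shows "proj_dominant E CARD('v)"
proof -
  have "partial_matrix_space E \<subseteq> graph_proj E ` sym_rank_variety CARD('v)"
  proof
    fix x assume x: "x \<in> partial_matrix_space E"
    obtain d w where dw: "x = (d, w)" by (cases x)
    define M :: "real^'v^'v" where "M = (\<chi> i j. if i = j then d $ i else w $ {i, j})"
    have sym: "transpose M = M"
      by (auto simp: M_def transpose_def vec_eq_iff insert_commute)
    moreover have "rank M \<le> CARD('v)" using rank_bound [of M] by simp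
    ultimately have M: "M \<in> sym_rank_variety CARD('v)" by (simp add: sym_rank_variety_def)
    have "edge_entry M e = w $ e" if "e \<in> E" for e
    proof -
      have "card e = 2" using assms that by (simp add: simple_graph_def)
      then obtain i j where ij: "e = {i, j}" "i \<noteq> j" by (metis card_2_iff)
      then show ?thesis using edge_entry_eq [OF sym] by (simp add: M_def)
    qed
    then have "graph_proj E M = x"
      using x by (auto simp: graph_proj_def dw vec_eq_iff partial_matrix_space_def M_def)
    then show "x \<in> graph_proj E ` sym_rank_variety CARD('v)" using M by blast
  qed
  then show ?thesis
    using graph_proj_in by (auto simp: proj_dominant_def zariski_dense_in_def)
qed

end

theory Submission
  imports Defs
begin

text \<open>For $r < m$ some $m \times m$ minor involves known entries only: rows \<open>A\<close> against $m$ columns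
  from \<open>B\<close> if $m \ge 3$, and the principal minor on an edge if $m = 2$. It vanishes on the image of
  $V_r$ but not identically.

  For $r = m$, Gram matrices of vectors $u_v \in R^m$ have rank at most $m$. Take $u_a = e_a$ for
  \<open>a \<in> A\<close>, and let the $u_b$ for \<open>b \<in> B\<close> run through all $e_k + e_l$. The derivative of the known
  entries at this configuration is onto: the velocities $\dot u_a$ form an $m \times m$ matrix $C$
  whose diagonal is given by the diagonal entries on \<open>A\<close>, the edges at \<open>b\<close> then determine
  $\dot u_b$, and the diagonal entry at \<open>b\<close> becomes a condition on $C_{kl} + C_{lk}$. Different \<open>b\<close>
  have different pairs $\{k, l\}$, so these conditions can be met independently. Hence the image
  contains an open set and is Zariski dense.\<close>

section \<open>Zariski density of images\<close>

lemma zariski_dense_in_mono: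
  "zariski_dense_in S T \<Longrightarrow> S \<subseteq> S' \<Longrightarrow> S' \<subseteq> T \<Longrightarrow> zariski_dense_in S' T"
  unfolding zariski_dense_in_def by blast

lemma real_polynomial_function_eq_0_if_interior_zeros:
  fixes p :: "'a::real_normed_vector \<Rightarrow> real"
  assumes poly: "real_polynomial_function p" and zeros: "z \<in> interior {x. p x = 0}"
  shows "p x = 0"
proof -
  define line where "line t = z + t *\<^sub>R (x - z)" for t :: real
  have "polynomial_function line"
    unfolding line_def
    by (intro polynomial_function_add polynomial_function_const polynomial_function_bounded_linear
        bounded_linear_scaleR_left)
  then have "real_polynomial_function (p \<circ> line)"
    using poly by (rule real_polynomial_function_compose)
  then obtain c n where p_line: "p \<circ> line = (\<lambda>t. \<Sum>i\<le>n. c i * t ^ i)"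
    using real_polynomial_function_imp_sum by blast
  have "line -` interior {x. p x = 0} \<subseteq> {t. (\<Sum>i\<le>n. c i * t ^ i) = 0}"
  proof
    fix t
    assume "t \<in> line -` interior {x. p x = 0}"
    then have "(p \<circ> line) t = 0"
      using interior_subset by auto
    then show "t \<in> {t. (\<Sum>i\<le>n. c i * t ^ i) = 0}"
      by (simp add: p_line)
  qed
  moreover have "open (line -` interior {x. p x = 0})"
    unfolding line_def by (intro open_vimage open_interior continuous_intros)
  moreover have "0 \<in> line -` interior {x. p x = 0}"
    using zeros by (simp add: line_def)
  ultimately have "0 \<in> interior {t. (\<Sum>i\<le>n. c i * t ^ i) = 0}"
    by (rule interiorI[rotated 2])
  then have "infinite {t. (\<Sum>i\<le>n. c i * t ^ i) = 0}"
    using empty_interior_finite by blast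
  then have "\<forall>i\<le>n. c i = 0"
    using polyfun_finite_roots by blast
  then have "(p \<circ> line) 1 = 0"
    by (simp add: p_line)
  then show ?thesis
    by (simp add: line_def)
qed

lemma interior_range_if_derivative_surj:
  fixes f :: "'a::euclidean_space \<Rightarrow> 'b::euclidean_space"
  assumes "continuous_on UNIV f" and "(f has_derivative f') (at a)" and "surj f'"
  shows "f a \<in> interior (range f)"
proof -
  have "linear f'"
    using assms(2) by (rule has_derivative_linear)
  then obtain g where "linear g" "f' \<circ> g = id"
    using linear_surjective_right_inverse assms(3) by blast
  then show ?thesis
    using sussmann_open_mapping[of UNIV f a f' g UNIV] assms(1,2)
    by (simp add: linear_conv_bounded_linear)
qed

lemma interior_range_plus_complement:
  fixes f :: "'a::euclidean_space \<Rightarrow> 'b::euclidean_space"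
  assumes \<pi>: "bounded_linear \<pi>" and cont: "continuous_on UNIV f"
    and deriv: "(f has_derivative f') (at a)" and onto: "range \<pi> \<subseteq> range f'"
  shows "f a \<in> interior (range (\<lambda>(x, y). f x + (y - \<pi> y)))"
proof -
  define F where "F z = f (fst z) + (snd z - \<pi> (snd z))" for z
  define F' where "F' k = f' (fst k) + (snd k - \<pi> (snd k))" for k
  have "continuous_on UNIV F"
    unfolding F_def
    by (intro continuous_intros continuous_on_compose2[OF cont] bounded_linear.continuous_on[OF \<pi>])
      auto
  moreover have "(F has_derivative F') (at (a, 0))"
  proof -
    have "((\<lambda>z :: 'a \<times> 'b. f (fst z)) has_derivative (\<lambda>k. f' (fst k))) (at (a, 0))"
      using has_derivative_compose[of fst fst "(a, 0)" UNIV f f'] deriv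
      by (simp add: has_derivative_fst)
    moreover have "((\<lambda>z. snd z - \<pi> (snd z)) has_derivative (\<lambda>k. snd k - \<pi> (snd k))) (at (a, 0))"
      by (intro has_derivative_diff bounded_linear.has_derivative[OF \<pi>] has_derivative_snd
          has_derivative_ident)
    ultimately show ?thesis
      unfolding F_def F'_def by (rule has_derivative_add)
  qed
  moreover have "surj F'"
    unfolding surj_def
  proof
    fix y
    obtain h where "\<pi> y = f' h"
      using onto by blast
    then have "y = F' (h, y)"
      by (simp add: F'_def)
    then show "\<exists>k. y = F' k" ..
  qed
  ultimately have "F (a, 0) \<in> interior (range F)"
    by (rule interior_range_if_derivative_surj)
  moreover have "F (a, 0) = f a"
    using \<pi> by (simp add: F_def bounded_linear.linear linear_0)
  ultimately show ?thesis
    by (simp add: F_def case_prod_unfold)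
qed

text \<open>As \<open>f\<close> takes its values in \<open>T\<close>, a projection \<open>\<pi>\<close> onto \<open>T\<close> maps \<open>f x + (y - \<pi> y)\<close> to
  \<open>f x\<close>. If \<open>p\<close> vanishes on the range of \<open>f\<close>, then \<open>p \<circ> \<pi>\<close> vanishes on an open set.\<close>

lemma zariski_dense_in_range_if_derivative_onto:
  fixes f :: "'a::euclidean_space \<Rightarrow> 'b::euclidean_space"
  assumes subspace: "subspace T" and f_in: "range f \<subseteq> T" and cont: "continuous_on UNIV f"
    and deriv: "(f has_derivative f') (at a)" and onto: "T \<subseteq> range f'"
  shows "zariski_dense_in (range f) T"
proof -
  obtain \<pi> :: "'b \<Rightarrow> 'b" where \<pi>: "range \<pi> \<subseteq> T" "linear \<pi>" "\<forall>y\<in>id ` T. id (\<pi> y) = y"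
    using linear_exists_right_inverse_on[OF linear_id subspace] by blast
  then have bounded_\<pi>: "bounded_linear \<pi>"
    by (simp add: linear_conv_bounded_linear)
  have \<pi>_id: "\<pi> y = y" if "y \<in> T" for y
    using \<pi>(3) that by simp
  have "f x \<in> T" "\<pi> y \<in> T" for x y
    using f_in \<pi>(1) by auto
  then have \<pi>_f: "\<pi> (f x + (y - \<pi> y)) = f x" for x y
    by (simp add: \<pi>_id linear_add[OF \<pi>(2)] linear_diff[OF \<pi>(2)])
  have open_point: "f a \<in> interior (range (\<lambda>(x, y). f x + (y - \<pi> y)))"
    using interior_range_plus_complement[OF bounded_\<pi> cont deriv] \<pi>(1) onto by blast
  have "p x = 0" if poly: "real_polynomial_function p" and zeros: "\<forall>y\<in>range f. p y = 0"
      and "x \<in> T" for p x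
  proof -
    have "real_polynomial_function (p \<circ> \<pi>)"
      using polynomial_function_bounded_linear[OF bounded_\<pi>] poly
      by (rule real_polynomial_function_compose)
    moreover have "range (\<lambda>(x, y). f x + (y - \<pi> y)) \<subseteq> {y. (p \<circ> \<pi>) y = 0}"
      using zeros by (auto simp: \<pi>_f)
    ultimately have "(p \<circ> \<pi>) x = 0"
      using open_point interior_mono
      by (blast intro: real_polynomial_function_eq_0_if_interior_zeros)
    then show ?thesis
      using \<pi>_id \<open>x \<in> T\<close> by simp
  qed
  then show ?thesis
    using f_in by (auto simp: zariski_dense_in_def)
qed

section \<open>Minors of matrices of small rank\<close>

lemma rank_add_le:
  fixes A B :: "real^'n^'m"
  shows "rank (A + B) \<le> rank A + rank B"
proof -
  have "range ((*v) (A + B)) \<subseteq> {x + y |x y. x \<in> range ((*v) A) \<and> y \<in> range ((*v) B)}"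
    by (auto simp: matrix_vector_mult_add_rdistrib)
  then have "rank (A + B) \<le> dim {x + y |x y. x \<in> range ((*v) A) \<and> y \<in> range ((*v) B)}"
    unfolding rank_dim_range by (rule dim_subset)
  also have "\<dots> \<le> rank A + rank B"
    using dim_sums_Int[of "range ((*v) A)" "range ((*v) B)"]
    by (simp add: rank_dim_range linear_subspace_image)
  finally show ?thesis .
qed

lemma rank_le_card_nonzero_rows:
  fixes A :: "real^'n^'m"
  assumes "\<And>i. i \<notin> I \<Longrightarrow> row i A = 0"
  shows "rank A \<le> card I"
proof -
  have "row i A \<in> span ((\<lambda>i. row i A) ` I)" for i
    using assms by (cases "i \<in> I") (auto intro: span_base span_zero)
  then have "rows A \<subseteq> span ((\<lambda>i. row i A) ` I)"
    by (auto simp: rows_def)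
  then have "rank A \<le> card ((\<lambda>i. row i A) ` I)"
    unfolding row_rank_def by (intro dim_le_card) auto
  also have "\<dots> \<le> card I"
    by (rule card_image_le) simp
  finally show ?thesis .
qed

text \<open>The identity block compensates for \<open>I\<close> being a set, while matrices are indexed by a type: the
  determinant is that of the block \<open>c\<close> on \<open>I\<close>.\<close>

definition pad_with_identity :: "'k::finite set \<Rightarrow> ('k \<Rightarrow> 'k \<Rightarrow> real) \<Rightarrow> real^'k^'k" where
  "pad_with_identity I c =
    (\<chi> i j. if i \<in> I \<and> j \<in> I then c i j else if i = j then 1 else 0)"

lemma det_pad_with_identity_eq_0:
  fixes M :: "real^'n^'m" and f :: "'k::finite \<Rightarrow> 'm" and g :: "'k \<Rightarrow> 'n"
  assumes "rank M < card I"
  shows "det (pad_with_identity I (\<lambda>i j. M $ f i $ g j)) = 0" (is "det ?N = 0")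
proof -
  define R :: "real^'m^'k" where "R = (\<chi> i u. if i \<in> I \<and> u = f i then 1 else 0)"
  define C :: "real^'k^'n" where "C = (\<chi> v j. if j \<in> I \<and> v = g j then 1 else 0)"
  define D :: "real^'k^'k" where "D = (\<chi> i j. if i \<notin> I \<and> i = j then 1 else 0)"
  have R_mult_M: "(R ** M) $ i $ v = (if i \<in> I then M $ f i $ v else 0)" for i v
    by (simp add: R_def matrix_matrix_mult_def mult_delta_left)
  have "(R ** M ** C) $ i $ j = (if i \<in> I \<and> j \<in> I then M $ f i $ g j else 0)" for i j
    by (auto simp: matrix_matrix_mult_def[of "R ** M"] R_mult_M C_def if_distrib cong: if_cong)
  then have "?N = R ** M ** C + D"
    by (auto simp: vec_eq_iff pad_with_identity_def D_def)
  then have "rank ?N \<le> rank (R ** M ** C) + rank D"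
    by (simp add: rank_add_le)
  also have "\<dots> \<le> rank M + card (- I)"
  proof (rule add_mono)
    show "rank (R ** M ** C) \<le> rank M"
      using rank_mul_le_left[of "R ** M" C] rank_mul_le_right[of R M] by linarith
    show "rank D \<le> card (- I)"
      by (rule rank_le_card_nonzero_rows) (auto simp: D_def row_def vec_eq_iff)
  qed
  also have "\<dots> < card I + card (- I)"
    using assms by simp
  also have "\<dots> = CARD('k)"
    by (subst card_Un_disjoint[symmetric]) (auto simp: Un_commute)
  finally show ?thesis
    by (simp add: det_eq_0_rank)
qed

lemma real_polynomial_function_det:
  fixes N :: "'a::real_normed_vector \<Rightarrow> real^'n::finite^'n"
  assumes "\<And>i j. real_polynomial_function (\<lambda>x. N x $ i $ j)"
  shows "real_polynomial_function (\<lambda>x. det (N x))"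
  unfolding det_def using assms
  by (intro real_polynomial_function_sum real_polynomial_function_prod
      real_polynomial_function.intros(2,4)) auto

section \<open>Lower bounds for dominance\<close>

definition known_entry :: "(real^'v) \<times> (real^('v set)) \<Rightarrow> 'v \<Rightarrow> 'v \<Rightarrow> real" where
  "known_entry x u v = (if u = v then fst x $ u else snd x $ {u, v})"

lemma known_entry_graph_proj:
  assumes "transpose M = M" "u = v \<or> {u, v} \<in> E"
  shows "known_entry (graph_proj E M) u v = M $ u $ v"
  using assms edge_entry_eq[OF assms(1)] by (auto simp: known_entry_def graph_proj_def)

lemma bounded_linear_known_entry: "bounded_linear (\<lambda>x. known_entry x u v)"
  unfolding known_entry_def
  by (cases "u = v")
    (simp_all add: bounded_linear_compose[OF bounded_linear_vec_nth bounded_linear_fst]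
      bounded_linear_compose[OF bounded_linear_vec_nth bounded_linear_snd])

lemma card_le_if_known_identity_submatrix:
  fixes E :: "'v::finite set set" and I :: "'k::finite set"
  assumes dom: "proj_dominant E r"
    and known: "\<And>i j. i \<in> I \<Longrightarrow> j \<in> I \<Longrightarrow> f i = g j \<or> {f i, g j} \<in> E"
    and x_in: "x \<in> partial_matrix_space E"
    and x_entry: "\<And>i j. i \<in> I \<Longrightarrow> j \<in> I \<Longrightarrow> known_entry x (f i) (g j) = (if i = j then 1 else 0)"
  shows "card I \<le> r"
proof (rule ccontr)
  assume less: "\<not> card I \<le> r"
  define N where "N y = pad_with_identity I (\<lambda>i j. known_entry y (f i) (g j))" for y
  have "real_polynomial_function (\<lambda>y. N y $ i $ j)" for i j
    by (cases "i \<in> I"; cases "j \<in> I"; cases "i = j")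
      (simp_all add: N_def pad_with_identity_def real_polynomial_function.intros(1,2)
        bounded_linear_known_entry)
  then have poly: "real_polynomial_function (\<lambda>y. det (N y))"
    by (rule real_polynomial_function_det)
  have "det (N (graph_proj E M)) = 0" if M_in: "M \<in> sym_rank_variety r" for M
  proof -
    have "N (graph_proj E M) = pad_with_identity I (\<lambda>i j. M $ f i $ g j)"
      using M_in known by (auto simp: N_def pad_with_identity_def vec_eq_iff sym_rank_variety_def
          known_entry_graph_proj)
    moreover have "rank M < card I"
      using M_in less by (simp add: sym_rank_variety_def)
    ultimately show ?thesis
      by (simp add: det_pad_with_identity_eq_0)
  qed
  then have "det (N x) = 0"
    using dom poly x_in unfolding proj_dominant_def zariski_dense_in_def by blast
  moreover have "N x = mat 1"
    using x_entry by (auto simp: N_def pad_with_identity_def mat_def vec_eq_iff)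
  ultimately show False
    by simp
qed

lemma card_clique_le_if_proj_dominant:
  assumes "proj_dominant E r" and "\<And>u v. u \<in> C \<Longrightarrow> v \<in> C \<Longrightarrow> u \<noteq> v \<Longrightarrow> {u, v} \<in> E"
  shows "card C \<le> r"
  using assms
  by (intro card_le_if_known_identity_submatrix[where f = id and g = id and x = "(1, 0)"])
    (auto simp: known_entry_def partial_matrix_space_def)

lemma card_biclique_le_if_proj_dominant:
  fixes E :: "'v::finite set set"
  assumes dom: "proj_dominant E r" and sub: "complete_bipartite C D \<subseteq> E"
    and disj: "C \<inter> D = {}" and card: "card C \<le> card D"
  shows "card C \<le> r"
proof -
  obtain g where g: "inj_on g C" "g ` C \<subseteq> D"
    using card_le_inj[of C D] card by auto
  have edge: "{i, g j} \<in> E" if "i \<in> C" "j \<in> C" for i j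
    using that g(2) sub by (auto simp: complete_bipartite_def)
  have neq: "i \<noteq> g j" if "i \<in> C" "j \<in> C" for i j
    using that g(2) disj by blast
  define x :: "(real^'v) \<times> (real^('v set))" where
    "x = (0, \<chi> e. if \<exists>i\<in>C. e = {i, g i} then 1 else 0)"
  have "known_entry x i (g j) = (if i = j then 1 else 0)" if ij: "i \<in> C" "j \<in> C" for i j
  proof -
    have "(\<exists>k\<in>C. {i, g j} = {k, g k}) \<longleftrightarrow> i = j"
      using ij neq g(1) by (auto simp: doubleton_eq_iff inj_on_def)
    then show ?thesis
      using ij neq by (simp add: known_entry_def x_def)
  qed
  moreover have "x \<in> partial_matrix_space E"
    using edge by (auto simp: x_def partial_matrix_space_def)
  ultimately show ?thesis
    using edge by (intro card_le_if_known_identity_submatrix[OF dom, where f = id and g = g]) auto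
qed

lemma two_le_if_proj_dominant:
  assumes "proj_dominant E r" and "simple_graph E" and "E \<noteq> {}"
  shows "2 \<le> r"
proof -
  obtain e where "e \<in> E" "card e = 2"
    using assms(2,3) by (auto simp: simple_graph_def)
  moreover then obtain u v where "e = {u, v}"
    by (meson card_2_iff)
  ultimately show ?thesis
    using card_clique_le_if_proj_dominant[OF assms(1), of e]
    by (metis doubleton_eq_iff insertE singletonD)
qed

lemma le_choose_two:
  assumes "3 \<le> (m::nat)"
  shows "m \<le> m choose 2"
proof -
  have "m * 2 \<le> m * (m - 1)"
    using assms by (intro mult_left_mono) auto
  then show ?thesis
    unfolding choose_two by linarith
qed

lemma card_le_if_proj_dominant_complete_bipartite:
  assumes dom: "proj_dominant (complete_bipartite A B) r" and disj: "A \<inter> B = {}"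
    and two: "2 \<le> card A" and card_B: "card B = card A choose 2"
  shows "card A \<le> r"
proof (cases "card A = 2")
  case True
  then have "A \<noteq> {}" "B \<noteq> {}"
    using card_B by auto
  then have "complete_bipartite A B \<noteq> {}"
    by (auto simp: complete_bipartite_def)
  then show ?thesis
    using two_le_if_proj_dominant[OF dom simple_graph_complete_bipartite[OF disj]] True by simp
next
  case False
  then have "card A \<le> card B"
    using le_choose_two[of "card A"] two card_B by simp
  with disj show ?thesis
    by (rule card_biclique_le_if_proj_dominant[OF dom order_refl])
qed

section \<open>Dominance through Gram matrices\<close>

lemma has_derivative_vec:
  fixes f :: "'a::real_normed_vector \<Rightarrow> 'b::euclidean_space^'n"
  assumes "\<And>i. ((\<lambda>x. f x $ i) has_derivative (\<lambda>h. f' h $ i)) (at a within S)"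
  shows "(f has_derivative f') (at a within S)"
  using assms
  by (subst has_derivative_componentwise_within)
    (auto simp: Basis_vec_def inner_axis intro: has_derivative_inner_left)

lemma subspace_partial_matrix_space: "subspace (partial_matrix_space E)"
  by (auto simp: subspace_def partial_matrix_space_def zero_prod_def)

lemma graph_proj_eqI:
  assumes "transpose M = M" and "x \<in> partial_matrix_space E" and "\<And>v. M $ v $ v = fst x $ v"
    and "\<And>e. e \<in> E \<Longrightarrow> \<exists>u v. e = {u, v} \<and> u \<noteq> v \<and> M $ u $ v = snd x $ e"
  shows "graph_proj E M = x"
proof -
  have "edge_entry M e = snd x $ e" if "e \<in> E" for e
    using assms(4)[OF that] edge_entry_eq[OF assms(1)] by metis
  then show ?thesis
    using assms(2,3)
    by (auto simp: graph_proj_def partial_matrix_space_def prod_eq_iff vec_eq_iff)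
qed

lemma has_derivative_graph_proj:
  fixes M :: "'a::real_normed_vector \<Rightarrow> real^'v::finite^'v"
  assumes simple: "simple_graph E"
    and sym: "\<And>x. transpose (M x) = M x" "\<And>h. transpose (M' h) = M' h"
    and deriv: "(M has_derivative M') (at a within S)"
  shows "((\<lambda>x. graph_proj E (M x)) has_derivative (\<lambda>h. graph_proj E (M' h))) (at a within S)"
proof -
  have entry: "((\<lambda>x. M x $ u $ v) has_derivative (\<lambda>h. M' h $ u $ v)) (at a within S)" for u v
    using deriv by (intro bounded_linear.has_derivative[OF bounded_linear_vec_nth])
  have "((\<lambda>x. if e \<in> E then edge_entry (M x) e else 0) has_derivative
      (\<lambda>h. if e \<in> E then edge_entry (M' h) e else 0)) (at a within S)" for e
  proof (cases "e \<in> E")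
    case True
    then obtain u v where "e = {u, v}" "u \<noteq> v"
      using simple by (metis simple_graph_def card_2_iff)
    then show ?thesis
      using entry True by (simp add: edge_entry_eq sym)
  qed simp
  then show ?thesis
    unfolding graph_proj_def by (intro has_derivative_Pair has_derivative_vec) (simp_all add: entry)
qed

definition gram_matrix :: "'k::finite set \<Rightarrow> real^'k^'v \<Rightarrow> real^'v^'v" where
  "gram_matrix K U = (\<chi> u v. \<Sum>i\<in>K. U $ u $ i * U $ v $ i)"

definition gram_deriv :: "'k::finite set \<Rightarrow> real^'k^'v \<Rightarrow> real^'k^'v \<Rightarrow> real^'v^'v" where
  "gram_deriv K U H = (\<chi> u v. \<Sum>i\<in>K. U $ u $ i * H $ v $ i + H $ u $ i * U $ v $ i)"

lemma transpose_gram_matrix: "transpose (gram_matrix K U) = gram_matrix K U"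
  by (simp add: transpose_def gram_matrix_def vec_eq_iff mult.commute)

lemma transpose_gram_deriv: "transpose (gram_deriv K U H) = gram_deriv K U H"
  by (simp add: transpose_def gram_deriv_def vec_eq_iff algebra_simps)

lemma gram_matrix_in_sym_rank_variety: "gram_matrix K U \<in> sym_rank_variety (card K)"
proof -
  define W where "W = (\<chi> i v. if i \<in> K then U $ v $ i else 0)"
  have "gram_matrix K U = transpose W ** W"
    by (auto simp: vec_eq_iff gram_matrix_def matrix_matrix_mult_def transpose_def W_def
        sum.If_cases if_distrib)
  moreover have "rank W \<le> card K"
    by (rule rank_le_card_nonzero_rows) (simp add: W_def row_def vec_eq_iff)
  ultimately have "rank (gram_matrix K U) \<le> card K"
    using rank_mul_le_right[of "transpose W" W] by simp
  then show ?thesis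
    by (simp add: sym_rank_variety_def transpose_gram_matrix)
qed

lemma has_derivative_gram_matrix:
  "(gram_matrix K has_derivative gram_deriv K U) (at U)"
proof -
  have "((\<lambda>U. U $ v $ i) has_derivative (\<lambda>H. H $ v $ i)) (at U)" for v i
    by (intro bounded_linear_imp_has_derivative bounded_linear_compose[OF bounded_linear_vec_nth]
        bounded_linear_vec_nth)
  then show ?thesis
    unfolding gram_matrix_def gram_deriv_def
    by (intro has_derivative_vec) (auto intro!: has_derivative_sum has_derivative_mult)
qed

lemma proj_dominant_if_gram_deriv_onto:
  fixes U :: "real^'k::finite^'v::finite"
  assumes simple: "simple_graph E"
    and onto: "\<And>x. x \<in> partial_matrix_space E \<Longrightarrow> \<exists>H.
      (\<forall>v. gram_deriv K U H $ v $ v = fst x $ v) \<and>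
      (\<forall>e\<in>E. \<exists>u v. e = {u, v} \<and> u \<noteq> v \<and> gram_deriv K U H $ u $ v = snd x $ e)"
  shows "proj_dominant E (card K)"
proof -
  let ?f = "\<lambda>U :: real^'k^'v. graph_proj E (gram_matrix K U)"
  have deriv: "(?f has_derivative (\<lambda>H. graph_proj E (gram_deriv K U H))) (at U)" for U
    using has_derivative_gram_matrix
    by (rule has_derivative_graph_proj[OF simple transpose_gram_matrix transpose_gram_deriv])
  then have "continuous_on UNIV ?f"
    by (auto simp: continuous_on_eq_continuous_at intro: has_derivative_continuous)
  moreover have "partial_matrix_space E \<subseteq> range (\<lambda>H. graph_proj E (gram_deriv K U H))"
  proof
    fix x
    assume x_in: "x \<in> partial_matrix_space E"
    obtain H where diag: "\<forall>v. gram_deriv K U H $ v $ v = fst x $ v"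
      and edge: "\<forall>e\<in>E. \<exists>u v. e = {u, v} \<and> u \<noteq> v \<and> gram_deriv K U H $ u $ v = snd x $ e"
      using onto[OF x_in] by (elim exE conjE)
    have "graph_proj E (gram_deriv K U H) = x"
      using diag edge by (intro graph_proj_eqI[OF transpose_gram_deriv x_in]) simp_all
    then show "x \<in> range (\<lambda>H. graph_proj E (gram_deriv K U H))"
      by blast
  qed
  ultimately have "zariski_dense_in (range ?f) (partial_matrix_space E)"
    using deriv graph_proj_in
    by (intro zariski_dense_in_range_if_derivative_onto[OF subspace_partial_matrix_space]) blast+
  moreover have "range ?f \<subseteq> graph_proj E ` sym_rank_variety (card K)"
    using gram_matrix_in_sym_rank_variety by blast
  moreover have "graph_proj E ` sym_rank_variety (card K) \<subseteq> partial_matrix_space E"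
    using graph_proj_in by blast
  ultimately show ?thesis
    unfolding proj_dominant_def by (rule zariski_dense_in_mono)
qed

section \<open>Complete bipartite graphs\<close>

lemma exists_matrix_with_diagonal_and_pair_sums:
  fixes d :: "'k \<Rightarrow> real" and t :: "'b \<Rightarrow> real"
  assumes inj: "inj_on \<tau> B" and pair: "\<And>b. b \<in> B \<Longrightarrow> card (\<tau> b) = 2"
  shows "\<exists>C. (\<forall>i. C i i = d i) \<and> (\<forall>b\<in>B. (\<Sum>i\<in>\<tau> b. \<Sum>j\<in>\<tau> b. C i j) = t b)"
proof -
  define s where "s b = (t b - (\<Sum>i\<in>\<tau> b. d i)) / 2" for b
  define C where "C i j = (if i = j then d i else s (inv_into B \<tau> {i, j}))" for i j
  have "(\<Sum>i\<in>\<tau> b. \<Sum>j\<in>\<tau> b. C i j) = t b" if b: "b \<in> B" for b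
  proof -
    obtain k l where kl: "\<tau> b = {k, l}" "k \<noteq> l"
      using pair[OF b] by (meson card_2_iff)
    then have "C k l = s b" "C l k = s b"
      using inv_into_f_f[OF inj b] by (simp_all add: C_def insert_commute)
    moreover have "C k k = d k" "C l l = d l"
      by (simp_all add: C_def)
    ultimately show ?thesis
      using kl by (simp add: s_def field_simps)
  qed
  moreover have "C i i = d i" for i
    by (simp add: C_def)
  ultimately show ?thesis
    by blast
qed

definition indicator_frame :: "('v \<Rightarrow> 'k set) \<Rightarrow> real^'k^'v" where
  "indicator_frame S = (\<chi> v i. if i \<in> S v then 1 else 0)"

lemma gram_deriv_indicator_frame:
  fixes S :: "'v::finite \<Rightarrow> 'k::finite set"
  assumes "\<And>v. S v \<subseteq> K"
  shows "gram_deriv K (indicator_frame S) H $ u $ v =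
    (\<Sum>i\<in>S u. H $ v $ i) + (\<Sum>i\<in>S v. H $ u $ i)"
proof -
  have "(\<Sum>i\<in>K. if i \<in> S w then F i else 0) = sum F (S w)" for w and F :: "'k \<Rightarrow> real"
    using assms by (simp add: Int_absorb1 flip: sum.inter_restrict)
  then show ?thesis
    by (simp add: gram_deriv_def indicator_frame_def sum.distrib mult_delta_left mult_delta_right)
qed

lemma exists_gram_deriv_with_known_entries:
  fixes A B :: "'v::finite set" and d :: "'v \<Rightarrow> real" and w :: "'v set \<Rightarrow> real"
  assumes cover: "A \<union> B = UNIV" and disj: "A \<inter> B = {}" and inj: "inj_on S B"
    and S_A: "\<And>a. a \<in> A \<Longrightarrow> S a = {a}"
    and S_B: "\<And>b. b \<in> B \<Longrightarrow> S b \<subseteq> A" "\<And>b. b \<in> B \<Longrightarrow> card (S b) = 2"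
  obtains H where "\<And>v. gram_deriv A (indicator_frame S) H $ v $ v = d v"
    and "\<And>a b. a \<in> A \<Longrightarrow> b \<in> B \<Longrightarrow> gram_deriv A (indicator_frame S) H $ a $ b = w {a, b}"
proof -
  obtain C where C_diag: "\<And>i. C i i = d i / 2"
    and C_pair: "\<And>b. b \<in> B \<Longrightarrow> (\<Sum>i\<in>S b. \<Sum>j\<in>S b. C i j) = (\<Sum>i\<in>S b. w {i, b}) - d b / 2"
    using exists_matrix_with_diagonal_and_pair_sums[OF inj S_B(2), of "\<lambda>i. d i / 2"
        "\<lambda>b. (\<Sum>i\<in>S b. w {i, b}) - d b / 2"] by blast
  define H where "H = (\<chi> v i. if v \<in> A then C v i else w {i, v} - (\<Sum>j\<in>S v. C i j))"
  have A_or_B: "v \<in> A \<or> v \<in> B" for v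
    using cover by blast
  have S_sub: "S v \<subseteq> A" for v
    using A_or_B[of v] S_A[of v] S_B(1)[of v] by auto
  note deriv_nth = gram_deriv_indicator_frame[of S A, OF S_sub]
  have not_A: "b \<notin> A" if "b \<in> B" for b
    using that disj by blast
  have "gram_deriv A (indicator_frame S) H $ a $ a = d a" if "a \<in> A" for a
    using that by (simp add: deriv_nth S_A H_def C_diag)
  moreover have "gram_deriv A (indicator_frame S) H $ b $ b = d b" if b: "b \<in> B" for b
  proof -
    have "gram_deriv A (indicator_frame S) H $ b $ b =
        2 * ((\<Sum>i\<in>S b. w {i, b}) - (\<Sum>i\<in>S b. \<Sum>j\<in>S b. C i j))"
      using not_A[OF b] by (simp add: deriv_nth H_def sum_subtractf)
    then show ?thesis
      using C_pair[OF b] by simp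
  qed
  moreover have "gram_deriv A (indicator_frame S) H $ a $ b = w {a, b}" if "a \<in> A" "b \<in> B" for a b
    using that not_A by (simp add: deriv_nth S_A H_def)
  ultimately show ?thesis
    using A_or_B by (intro that) blast+
qed

lemma proj_dominant_complete_bipartite:
  fixes A B :: "'v::finite set"
  assumes cover: "A \<union> B = UNIV" and disj: "A \<inter> B = {}" and card: "card B \<le> card A choose 2"
  shows "proj_dominant (complete_bipartite A B) (card A)"
proof -
  have "card B \<le> card {e. e \<subseteq> A \<and> card e = 2}"
    using card by (simp add: n_subsets)
  then obtain \<tau> where \<tau>: "inj_on \<tau> B" "\<tau> ` B \<subseteq> {e. e \<subseteq> A \<and> card e = 2}"
    using card_le_inj[of B "{e. e \<subseteq> A \<and> card e = 2}"] by auto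
  define S where "S v = (if v \<in> A then {v} else \<tau> v)" for v
  have S_A: "S a = {a}" if "a \<in> A" for a
    using that by (simp add: S_def)
  have S_B: "S b = \<tau> b" if "b \<in> B" for b
    using that disj by (auto simp: S_def)
  have inj: "inj_on S B"
    using \<tau>(1) S_B by (simp cong: inj_on_cong)
  have pair: "S b \<subseteq> A" "card (S b) = 2" if "b \<in> B" for b
    using that \<tau>(2) S_B by auto
  show ?thesis
  proof (rule proj_dominant_if_gram_deriv_onto[OF simple_graph_complete_bipartite[OF disj]])
    fix x :: "(real^'v) \<times> (real^('v set))"
    obtain H where diag: "\<And>v. gram_deriv A (indicator_frame S) H $ v $ v = fst x $ v"
      and edge: "\<And>a b. a \<in> A \<Longrightarrow> b \<in> B \<Longrightarrow>
        gram_deriv A (indicator_frame S) H $ a $ b = snd x $ {a, b}"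
      using exists_gram_deriv_with_known_entries[OF cover disj inj S_A pair,
          of "\<lambda>v. fst x $ v" "\<lambda>e. snd x $ e"] by blast
    show "\<exists>H. (\<forall>v. gram_deriv A (indicator_frame S) H $ v $ v = fst x $ v) \<and>
        (\<forall>e\<in>complete_bipartite A B. \<exists>u v. e = {u, v} \<and> u \<noteq> v \<and>
          gram_deriv A (indicator_frame S) H $ u $ v = snd x $ e)"
      using diag edge disj unfolding complete_bipartite_def by blast
  qed
qed

theorem theorem2p5:
  fixes A B :: "'v::finite set" and m n :: nat
  assumes "m \<ge> 2" and "n = m choose 2"
    and "A \<union> B = UNIV" and "A \<inter> B = {}" and "card A = m" and "card B = n"
  shows "gcr (complete_bipartite A B) = m"
  unfolding gcr_def
proof (rule Least_equality)
  show "proj_dominant (complete_bipartite A B) m"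
    using proj_dominant_complete_bipartite[of A B] assms by simp
next
  fix r
  assume "proj_dominant (complete_bipartite A B) r"
  then show "m \<le> r"
    using card_le_if_proj_dominant_complete_bipartite[of A B r] assms by simp
qed

end
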